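(* Suppose single-shot PBFT is run with a synchronizer that satisfies the specification (P1)-(P5) given in the context for some view $\mathcal V$ and $d=2\delta$, whose timeout function $F$ satisfies: for every $\theta$ there is a view $v$ such that $F(v')>\theta$ for all $v'\ge v$. Then all correct processes eventually decide.
   Context: Model. There are $n=3f+1$ processes $p_1,\dots,p_n$, at most $f$ of which are faulty (Byzantine, behaving arbitrarily); the others are correct. A quorum is a set of $2f+1$ processes. Processes communicate over authenticated point-to-point links. Partial synchrony: there are a time $\mathsf{GST}$ and a bound $\delta$, both unknown to the protocol, such that after $\mathsf{GST}$ messages between correct processes are delayed by at most $\delta$; before $\mathsf{GST}$ messages may be arbitrarily delayed or lost (self-addressed messages are never lost). Local clocks may drift unboundedly before $\mathsf{GST}$ and do not drift from real time after it. Local processing takes zero time. $\langle m\rangle_i$ denotes $m$ signed by $p_i$; signatures are unforgeable and $\mathsf{hash}$ is collision-resistant (both idealized as perfect). Each correct process has a proposal $\mathtt{myval}()$ satisfying a given predicate $\mathsf{valid}$. Synchronizer. Views are $1,2,\dots$; $0$ denotes an invalid view. A synchronizer issues notifications $\mathtt{new\_view}(v)$ at each correct process, which then enters $v$ and stays in it until it enters another view. Each correct process eventually calls the synchronizer's function $\mathtt{start}()$. The timeout function $F:\{0,1,2,\dots\}\to\mathsf{Time}$ is monotone with $F(0)=0$. $E_i(v)$ is the time when correct $p_i$ enters $v$; $E_{\rm first}(v)$, $E_{\rm last}(v)$ are the earliest and latest times when some correct process enters $v$. Specification, for a view $\mathcal V$: (P1) if $v<v'$ and $E_i(v),E_i(v')$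 are defined then $E_i(v)<E_i(v')$; (P2) $E_{\rm first}(\mathcal V)\ge\mathsf{GST}$; (P3) every correct process enters every $v\ge\mathcal V$; (P4) $E_{\rm last}(v)\le E_{\rm first}(v)+d$ for all $v\ge\mathcal V$; (P5) $E_{\rm first}(v+1)\ge E_{\rm first}(v)+F(v)$ for all $v\ge\mathcal V$. Single-shot (all-to-all) PBFT (code of $p_i$). $\mathsf{leader}(v)=p_{((v-1)\bmod n)+1}$. Variables $\mathsf{curr\_view},\mathsf{locked\_view}$ are initially $0$; $\mathsf{curr\_val},\mathsf{prepared\_val},\mathsf{cert},\mathsf{voted}$ are initially $\bot$. A handler runs when its trigger and precondition hold; messages for views higher than the current one are buffered (for each type and sender, only the one with the highest view is kept). "All" includes the sender. 1. Upon $\mathtt{new\_view}(v)$: $\mathsf{curr\_view}:=v$; $\mathsf{voted}:=$ false; send $\langle\mathtt{NEWLEADER}(v,\mathsf{locked\_view},\mathsf{prepared\_val},\mathsf{cert})\rangle_i$ to $\mathsf{leader}(v)$. 2. (Once per view.) When messages $M=\{\langle\mathtt{NEWLEADER}(v,view_j,val_j,cert_j)\rangle_j\mid p_j\in Q\}$ are received for a quorum $Q$, with $\mathsf{curr\_view}=v$, $p_i=\mathsf{leader}(v)$ and ValidNewLeader$(m)$ for all $m\in M$: if there is $j$ with $view_j=\max\{view_k\mid p_k\in Q\}\ne0$, send $\langle\mathtt{PROPOSE}(v,val_j,M)\rangle_i$ to all; else send $\langle\mathtt{PROPOSE}(v,\mathtt{myval}(),M)\rangle_i$ to all. 3. When $m=\langle\mathtt{PROPOSE}(v,x,\_)\rangle_j$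 is received, with $\mathsf{curr\_view}=v$, $\mathsf{voted}=$ false, SafeProposal$(m)$: $\mathsf{curr\_val}:=x$; $\mathsf{voted}:=$ true; send $\langle\mathtt{PREPARED}(v,\mathsf{hash}(x))\rangle_i$ to all. 4. When $C=\{\langle\mathtt{PREPARED}(v,h)\rangle_j\mid p_j\in Q\}$ is received for a quorum $Q$, with $\mathsf{curr\_view}=v$, $\mathsf{voted}=$ true, $\mathsf{hash}(\mathsf{curr\_val})=h$: $\mathsf{prepared\_val}:=\mathsf{curr\_val}$; $\mathsf{locked\_view}:=v$; $\mathsf{cert}:=C$; send $\langle\mathtt{COMMITTED}(v,h)\rangle_i$ to all. 5. When $\{\langle\mathtt{COMMITTED}(v,h)\rangle_j\mid p_j\in Q\}$ is received for a quorum $Q$, with $\mathsf{curr\_view}=\mathsf{locked\_view}=v$, $\mathsf{hash}(\mathsf{curr\_val})=h$: decide $\mathsf{curr\_val}$. View-1 optimization: in view $1$ the leader proposes $\mathtt{myval}()$ immediately on entering, without waiting for $\mathtt{NEWLEADER}$ messages (which need not be sent to it), and SafeProposal for view $1$ only requires that the sender is $\mathsf{leader}(1)$ and the value is valid. Predicates: prepared$(C,v,h)$ iff $C=\{\langle\mathtt{PREPARED}(v,h)\rangle_j\mid p_j\in Q\}$ for some quorum $Q$. ValidNewLeader$(\langle\mathtt{NEWLEADER}(v',v,x,C)\rangle_{\_})$ iff $v<v'$ and ($v\ne0$ implies prepared$(C,v,\mathsf{hash}(x))$). SafeProposal$(\langle\mathtt{PROPOSE}(v,x,M)\rangle_i)$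 iff $p_i=\mathsf{leader}(v)$, $\mathsf{valid}(x)$, and there is a quorum $Q$ such that $M=\{\langle\mathtt{NEWLEADER}(v,view_j,val_j,cert_j)\rangle_j\mid p_j\in Q\}$, ValidNewLeader$(m)$ for all $m\in M$, and (if $view_j\ne0$ for some $j$, then there is $j$ with $view_j=\max\{view_k\mid p_k\in Q\}$ and $x=val_j$). *)

theory Defs
  imports Complex_Main
begin

text \<open>Processes are the numbers \<open>1, \<dots>, n\<close> with \<open>n = 3 f + 1\<close>; views are natural numbers,
  \<open>0\<close> being the invalid view. The type variables \<open>'x\<close> and \<open>'h\<close> stand for values and hashes;
  \<open>None\<close> renders the undefined value \<open>\<bottom>\<close>.\<close>

type_synonym proc = nat
type_synonym view = nat

definition procs :: "nat \<Rightarrow> proc set" where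
  "procs f = {1..3 * f + 1}"

definition quorum :: "nat \<Rightarrow> proc set \<Rightarrow> bool" where
  "quorum f Q \<longleftrightarrow> Q \<subseteq> procs f \<and> card Q = 2 * f + 1"

definition leader :: "nat \<Rightarrow> view \<Rightarrow> proc" where
  "leader f v = (v - 1) mod (3 * f + 1) + 1"

section \<open>Messages\<close>

datatype 'a signed = Signed (signer: proc) (body: 'a)

datatype 'h prepared = PREPARED view 'h
datatype 'h committed = COMMITTED view 'h
datatype ('x, 'h) newleader =
  NEWLEADER view view "'x option" "'h prepared signed set option"
datatype ('x, 'h) propose =
  PROPOSE view 'x "('x, 'h) newleader signed set"

datatype ('x, 'h) msg =
    NewLeaderMsg "('x, 'h) newleader signed"
  | ProposeMsg "('x, 'h) propose signed"
  | PreparedMsg "'h prepared signed"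
  | CommittedMsg "'h committed signed"

fun msg_view :: "('x, 'h) msg \<Rightarrow> view" where
  "msg_view (NewLeaderMsg (Signed _ (NEWLEADER v _ _ _))) = v"
| "msg_view (ProposeMsg (Signed _ (PROPOSE v _ _))) = v"
| "msg_view (PreparedMsg (Signed _ (PREPARED v _))) = v"
| "msg_view (CommittedMsg (Signed _ (COMMITTED v _))) = v"

fun msg_signer :: "('x, 'h) msg \<Rightarrow> proc" where
  "msg_signer (NewLeaderMsg m) = signer m"
| "msg_signer (ProposeMsg m) = signer m"
| "msg_signer (PreparedMsg m) = signer m"
| "msg_signer (CommittedMsg m) = signer m"

datatype kind = NewLeaderKind | ProposeKind | PreparedKind | CommittedKind

fun msg_kind :: "('x, 'h) msg \<Rightarrow> kind" where
  "msg_kind (NewLeaderMsg _) = NewLeaderKind"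
| "msg_kind (ProposeMsg _) = ProposeKind"
| "msg_kind (PreparedMsg _) = PreparedKind"
| "msg_kind (CommittedMsg _) = CommittedKind"

text \<open>All signed messages occurring in a message, the message itself included. A message may
  only be sent by a faulty process if none of these is a forgery.\<close>

fun newleader_parts :: "('x, 'h) newleader signed \<Rightarrow> ('x, 'h) msg set" where
  "newleader_parts (Signed i (NEWLEADER v' v x None)) =
     {NewLeaderMsg (Signed i (NEWLEADER v' v x None))}"
| "newleader_parts (Signed i (NEWLEADER v' v x (Some C))) =
     insert (NewLeaderMsg (Signed i (NEWLEADER v' v x (Some C)))) (PreparedMsg ` C)"

fun msg_parts :: "('x, 'h) msg \<Rightarrow> ('x, 'h) msg set" where
  "msg_parts (NewLeaderMsg m) = newleader_parts m"
| "msg_parts (ProposeMsg (Signed i (PROPOSE v x M))) =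
     insert (ProposeMsg (Signed i (PROPOSE v x M))) (\<Union>m\<in>M. newleader_parts m)"
| "msg_parts (PreparedMsg m) = {PreparedMsg m}"
| "msg_parts (CommittedMsg m) = {CommittedMsg m}"

section \<open>Predicates on messages\<close>

definition is_prepared :: "nat \<Rightarrow> 'h prepared signed set \<Rightarrow> view \<Rightarrow> 'h \<Rightarrow> bool" where
  "is_prepared f C v h \<longleftrightarrow> (\<exists>Q. quorum f Q \<and> C = (\<lambda>j. Signed j (PREPARED v h)) ` Q)"

fun valid_new_leader :: "nat \<Rightarrow> ('x \<Rightarrow> 'h) \<Rightarrow> ('x, 'h) newleader signed \<Rightarrow> bool" where
  "valid_new_leader f hash (Signed _ (NEWLEADER v' v x C)) \<longleftrightarrow>
     v < v' \<and>
     (v \<noteq> 0 \<longrightarrow> (\<exists>y D. x = Some y \<and> C = Some D \<and> is_prepared f D v (hash y)))"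

text \<open>\<open>M\<close> consists of one valid NEWLEADER message for view \<open>v\<close> from each member \<open>j\<close> of the
  quorum \<open>Q\<close>, carrying the view \<open>view j\<close> and the value \<open>val j\<close>.\<close>

definition new_leader_quorum ::
    "nat \<Rightarrow> ('x \<Rightarrow> 'h) \<Rightarrow> view \<Rightarrow> proc set \<Rightarrow> (proc \<Rightarrow> view) \<Rightarrow> (proc \<Rightarrow> 'x option) \<Rightarrow>
     ('x, 'h) newleader signed set \<Rightarrow> bool" where
  "new_leader_quorum f hash v Q view val M \<longleftrightarrow>
     quorum f Q \<and>
     (\<exists>cert. M = (\<lambda>j. Signed j (NEWLEADER v (view j) (val j) (cert j))) ` Q) \<and>
     (\<forall>m\<in>M. valid_new_leader f hash m)"

fun safe_proposal ::
    "nat \<Rightarrow> ('x \<Rightarrow> bool) \<Rightarrow> ('x \<Rightarrow> 'h) \<Rightarrow> ('x, 'h) propose signed \<Rightarrow> bool" where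
  "safe_proposal f valid hash (Signed i (PROPOSE v x M)) \<longleftrightarrow>
     i = leader f v \<and> valid x \<and>
     (v \<noteq> 1 \<longrightarrow>
       (\<exists>Q view val. new_leader_quorum f hash v Q view val M \<and>
          ((\<exists>j\<in>Q. view j \<noteq> 0) \<longrightarrow>
             (\<exists>j\<in>Q. view j = Max (view ` Q) \<and> val j = Some x))))"

section \<open>Local states and handlers of a correct process\<close>

datatype handler = Proposing | Voting | Preparing | Deciding

text \<open>\<open>ran\<close> records the handlers executed since the current view was entered; it renders the
  "once per view" restriction on proposing and tells which enabled handlers still have to be
  executed. \<open>received\<close> holds the messages available to the handlers, \<open>buffer\<close> those for views
  higher than the current one, at most one for each type and signer.\<close>

record ('x, 'h) lstate =
  curr_view :: view
  locked_view :: view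
  curr_val :: "'x option"
  prepared_val :: "'x option"
  cert :: "'h prepared signed set option"
  voted :: "bool option"
  ran :: "handler set"
  received :: "('x, 'h) msg set"
  buffer :: "kind \<times> proc \<Rightarrow> ('x, 'h) msg option"

definition init_state :: "('x, 'h) lstate" where
  "init_state = \<lparr>curr_view = 0, locked_view = 0, curr_val = None, prepared_val = None,
     cert = None, voted = None, ran = {}, received = {}, buffer = (\<lambda>_. None)\<rparr>"

definition buffer_insert ::
    "(kind \<times> proc \<Rightarrow> ('x, 'h) msg option) \<Rightarrow> ('x, 'h) msg \<Rightarrow>
     (kind \<times> proc \<Rightarrow> ('x, 'h) msg option) \<Rightarrow> bool" where
  "buffer_insert b m b' \<longleftrightarrow>
     (let slot = (msg_kind m, msg_signer m) in
      case b slot of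
        None \<Rightarrow> b' = b(slot := Some m)
      | Some m' \<Rightarrow>
          if msg_view m' < msg_view m then b' = b(slot := Some m)
          else if msg_view m' = msg_view m then b' = b \<or> b' = b(slot := Some m)
          else b' = b)"

definition can_propose ::
    "nat \<Rightarrow> ('x \<Rightarrow> 'h) \<Rightarrow> (proc \<Rightarrow> 'x) \<Rightarrow> proc \<Rightarrow> ('x, 'h) lstate \<Rightarrow>
     'x \<Rightarrow> ('x, 'h) newleader signed set \<Rightarrow> bool" where
  "can_propose f hash myval i s x M \<longleftrightarrow>
     Proposing \<notin> ran s \<and> i = leader f (curr_view s) \<and> NewLeaderMsg ` M \<subseteq> received s \<and>
     (\<exists>Q view val. new_leader_quorum f hash (curr_view s) Q view val M \<and>
        (if Max (view ` Q) \<noteq> 0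
         then \<exists>j\<in>Q. view j = Max (view ` Q) \<and> val j = Some x
         else x = myval i))"

definition can_vote ::
    "nat \<Rightarrow> ('x \<Rightarrow> bool) \<Rightarrow> ('x \<Rightarrow> 'h) \<Rightarrow> ('x, 'h) lstate \<Rightarrow> ('x, 'h) propose signed \<Rightarrow> bool" where
  "can_vote f valid hash s m \<longleftrightarrow>
     ProposeMsg m \<in> received s \<and> msg_view (ProposeMsg m) = curr_view s \<and>
     voted s = Some False \<and> safe_proposal f valid hash m"

definition can_prepare ::
    "nat \<Rightarrow> ('x \<Rightarrow> 'h) \<Rightarrow> ('x, 'h) lstate \<Rightarrow> 'h prepared signed set \<Rightarrow> 'x \<Rightarrow> bool" where
  "can_prepare f hash s C x \<longleftrightarrow>
     PreparedMsg ` C \<subseteq> received s \<and> is_prepared f C (curr_view s) (hash x) \<and>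
     voted s = Some True \<and> curr_val s = Some x"

definition can_decide :: "nat \<Rightarrow> ('x \<Rightarrow> 'h) \<Rightarrow> ('x, 'h) lstate \<Rightarrow> 'x \<Rightarrow> bool" where
  "can_decide f hash s x \<longleftrightarrow>
     (\<exists>Q. quorum f Q \<and>
        (\<lambda>j. CommittedMsg (Signed j (COMMITTED (curr_view s) (hash x)))) ` Q \<subseteq> received s) \<and>
     locked_view s = curr_view s \<and> curr_val s = Some x"

text \<open>Some handler is enabled and has not been executed in the current view. Since processing
  takes zero time, time may not pass in such a state.\<close>

definition handler_pending ::
    "nat \<Rightarrow> ('x \<Rightarrow> bool) \<Rightarrow> ('x \<Rightarrow> 'h) \<Rightarrow> (proc \<Rightarrow> 'x) \<Rightarrow> proc \<Rightarrow> ('x, 'h) lstate \<Rightarrow> bool" where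
  "handler_pending f valid hash myval i s \<longleftrightarrow>
     (\<exists>x M. can_propose f hash myval i s x M) \<or>
     (\<exists>m. can_vote f valid hash s m) \<or>
     Preparing \<notin> ran s \<and> (\<exists>C x. can_prepare f hash s C x) \<or>
     Deciding \<notin> ran s \<and> (\<exists>x. can_decide f hash s x)"

datatype ('x, 'h) event =
    Idle
  | Start
  | NewView view
  | Receive proc "('x, 'h) msg"
  | Propose 'x "('x, 'h) newleader signed set"
  | Vote "('x, 'h) propose signed"
  | Prepare "'h prepared signed set"
  | Decide 'x

type_synonym ('x, 'h) packets = "(proc \<times> proc \<times> ('x, 'h) msg) set"

definition to_all :: "nat \<Rightarrow> proc \<Rightarrow> ('x, 'h) msg \<Rightarrow> ('x, 'h) packets" where
  "to_all f i m = {(i, j, m) |j. j \<in> procs f}"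

definition new_leader_packet :: "nat \<Rightarrow> proc \<Rightarrow> ('x, 'h) lstate \<Rightarrow> view \<Rightarrow> ('x, 'h) packets" where
  "new_leader_packet f i s v =
     {(i, leader f v,
       NewLeaderMsg (Signed i (NEWLEADER v (locked_view s) (prepared_val s) (cert s))))}"

text \<open>Entering \<open>v\<close> makes the messages buffered for \<open>v\<close> available, and keeps buffered only those
  for views above \<open>v\<close>.\<close>

definition enter_view :: "view \<Rightarrow> ('x, 'h) lstate \<Rightarrow> ('x, 'h) lstate" where
  "enter_view v s =
     s\<lparr>curr_view := v, voted := Some False, ran := {},
       received := received s \<union> {m. \<exists>slot. buffer s slot = Some m \<and> msg_view m \<le> v},
       buffer := (\<lambda>slot. case buffer s slot of
                    None \<Rightarrow> None
                  | Some m \<Rightarrow> if v < msg_view m then Some m else None)\<rparr>"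

text \<open>\<open>local_step f valid hash myval i s e s' S\<close>: by event \<open>e\<close> the correct process \<open>i\<close> goes from
  state \<open>s\<close> to \<open>s'\<close>, sending the packets \<open>S\<close> (triples of link sender, destination and message).
  On entering view \<open>1\<close> the leader proposes at once and the NEWLEADER messages are optional.\<close>

inductive local_step ::
    "nat \<Rightarrow> ('x \<Rightarrow> bool) \<Rightarrow> ('x \<Rightarrow> 'h) \<Rightarrow> (proc \<Rightarrow> 'x) \<Rightarrow> proc \<Rightarrow>
     ('x, 'h) lstate \<Rightarrow> ('x, 'h) event \<Rightarrow> ('x, 'h) lstate \<Rightarrow> ('x, 'h) packets \<Rightarrow> bool"
  for f :: nat and valid :: "'x \<Rightarrow> bool" and hash :: "'x \<Rightarrow> 'h" and myval :: "proc \<Rightarrow> 'x"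
    and i :: proc
  where
  idle: "local_step f valid hash myval i s Idle s {}"
| start: "local_step f valid hash myval i s Start s {}"
| new_view:
    "1 < v \<Longrightarrow>
     local_step f valid hash myval i s (NewView v) (enter_view v s) (new_leader_packet f i s v)"
| new_view_1_leader:
    "i = leader f 1 \<Longrightarrow> N = {} \<or> N = new_leader_packet f i s 1 \<Longrightarrow>
     local_step f valid hash myval i s (NewView 1) ((enter_view 1 s)\<lparr>ran := {Proposing}\<rparr>)
       (N \<union> to_all f i (ProposeMsg (Signed i (PROPOSE 1 (myval i) {}))))"
| new_view_1_other:
    "i \<noteq> leader f 1 \<Longrightarrow> N = {} \<or> N = new_leader_packet f i s 1 \<Longrightarrow>
     local_step f valid hash myval i s (NewView 1) (enter_view 1 s) N"
| receive_now:
    "msg_view m \<le> curr_view s \<Longrightarrow>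
     local_step f valid hash myval i s (Receive j m) (s\<lparr>received := insert m (received s)\<rparr>) {}"
| receive_buffered:
    "curr_view s < msg_view m \<Longrightarrow> buffer_insert (buffer s) m b \<Longrightarrow>
     local_step f valid hash myval i s (Receive j m) (s\<lparr>buffer := b\<rparr>) {}"
| propose:
    "can_propose f hash myval i s x M \<Longrightarrow>
     local_step f valid hash myval i s (Propose x M) (s\<lparr>ran := insert Proposing (ran s)\<rparr>)
       (to_all f i (ProposeMsg (Signed i (PROPOSE (curr_view s) x M))))"
| vote:
    "can_vote f valid hash s m \<Longrightarrow> body m = PROPOSE v x M \<Longrightarrow>
     local_step f valid hash myval i s (Vote m)
       (s\<lparr>curr_val := Some x, voted := Some True, ran := insert Voting (ran s)\<rparr>)
       (to_all f i (PreparedMsg (Signed i (PREPARED v (hash x)))))"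
| prepare:
    "can_prepare f hash s C x \<Longrightarrow>
     local_step f valid hash myval i s (Prepare C)
       (s\<lparr>prepared_val := curr_val s, locked_view := curr_view s, cert := Some C,
          ran := insert Preparing (ran s)\<rparr>)
       (to_all f i (CommittedMsg (Signed i (COMMITTED (curr_view s) (hash x)))))"
| decide:
    "can_decide f hash s x \<Longrightarrow>
     local_step f valid hash myval i s (Decide x) (s\<lparr>ran := insert Deciding (ran s)\<rparr>) {}"

section \<open>Runs\<close>

text \<open>At step \<open>k\<close>, performed at real time \<open>clock k\<close>, process \<open>actor k\<close> executes \<open>event k\<close> and sends
  the packets \<open>sent k\<close>; \<open>state k i\<close> is the state of a correct process \<open>i\<close> before step \<open>k\<close>.
  Several steps may happen at the same time. States and events of faulty processes are
  meaningless; only the packets they send matter.\<close>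

record ('x, 'h) run =
  clock :: "nat \<Rightarrow> real"
  actor :: "nat \<Rightarrow> proc"
  event :: "nat \<Rightarrow> ('x, 'h) event"
  sent :: "nat \<Rightarrow> ('x, 'h) packets"
  state :: "nat \<Rightarrow> proc \<Rightarrow> ('x, 'h) lstate"

text \<open>A faulty process can send anything over its own links, except that every signature of a
  correct process it uses must be on a message which that process has already sent.\<close>

definition faulty_step :: "proc set \<Rightarrow> ('x, 'h) run \<Rightarrow> nat \<Rightarrow> bool" where
  "faulty_step correct r k \<longleftrightarrow>
     (\<forall>(i, j, m) \<in> sent r k. i = actor r k \<and>
        (\<forall>m'\<in>msg_parts m. msg_signer m' \<in> correct \<longrightarrow>
           (\<exists>k'<k. \<exists>j'. (msg_signer m', j', m') \<in> sent r k')))"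

definition pbft_run ::
    "nat \<Rightarrow> proc set \<Rightarrow> ('x \<Rightarrow> bool) \<Rightarrow> ('x \<Rightarrow> 'h) \<Rightarrow> (proc \<Rightarrow> 'x) \<Rightarrow> ('x, 'h) run \<Rightarrow> bool" where
  "pbft_run f correct valid hash myval r \<longleftrightarrow>
     0 \<le> clock r 0 \<and> mono (clock r) \<and> filterlim (clock r) at_top sequentially \<and>
     (\<forall>i\<in>correct. state r 0 i = init_state) \<and>
     (\<forall>k. actor r k \<in> procs f) \<and>
     (\<forall>k. actor r k \<in> correct \<longrightarrow>
        local_step f valid hash myval (actor r k) (state r k (actor r k)) (event r k)
          (state r (Suc k) (actor r k)) (sent r k)) \<and>
     (\<forall>k. actor r k \<notin> correct \<longrightarrow> faulty_step correct r k) \<and>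
     (\<forall>k. \<forall>i\<in>correct. i \<noteq> actor r k \<longrightarrow> state r (Suc k) i = state r k i) \<and>
     (\<forall>k j m. actor r k \<in> correct \<longrightarrow> event r k = Receive j m \<longrightarrow>
        (\<exists>k'<k. (j, actor r k, m) \<in> sent r k')) \<and>
     (\<forall>k. clock r k < clock r (Suc k) \<longrightarrow>
        (\<forall>i\<in>correct. \<not> handler_pending f valid hash myval i (state r (Suc k) i))) \<and>
     (\<forall>i\<in>correct. \<exists>k. actor r k = i \<and> event r k = Start)"

text \<open>Messages sent before \<open>GST\<close> need not be delivered at all, unless they are self-addressed.\<close>

definition partially_synchronous :: "proc set \<Rightarrow> real \<Rightarrow> real \<Rightarrow> ('x, 'h) run \<Rightarrow> bool" where
  "partially_synchronous correct GST \<delta> r \<longleftrightarrow>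
     0 \<le> GST \<and> 0 \<le> \<delta> \<and>
     (\<forall>k. \<forall>i\<in>correct. \<forall>j\<in>correct. \<forall>m. (i, j, m) \<in> sent r k \<longrightarrow> GST \<le> clock r k \<longrightarrow>
        (\<exists>k'>k. actor r k' = j \<and> event r k' = Receive i m \<and> clock r k' \<le> clock r k + \<delta>)) \<and>
     (\<forall>k. \<forall>i\<in>correct. \<forall>m. (i, i, m) \<in> sent r k \<longrightarrow>
        (\<exists>k'>k. actor r k' = i \<and> event r k' = Receive i m))"

section \<open>The synchronizer specification\<close>

definition enters_at :: "('x, 'h) run \<Rightarrow> proc \<Rightarrow> view \<Rightarrow> nat \<Rightarrow> bool" where
  "enters_at r i v k \<longleftrightarrow> actor r k = i \<and> event r k = NewView v"

definition enters :: "('x, 'h) run \<Rightarrow> proc \<Rightarrow> view \<Rightarrow> bool" where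
  "enters r i v \<longleftrightarrow> (\<exists>k. enters_at r i v k)"

definition entry_time :: "('x, 'h) run \<Rightarrow> proc \<Rightarrow> view \<Rightarrow> real" where
  "entry_time r i v = clock r (THE k. enters_at r i v k)"

definition first_entry :: "proc set \<Rightarrow> ('x, 'h) run \<Rightarrow> view \<Rightarrow> real" where
  "first_entry correct r v = Min {entry_time r i v |i. i \<in> correct \<and> enters r i v}"

definition last_entry :: "proc set \<Rightarrow> ('x, 'h) run \<Rightarrow> view \<Rightarrow> real" where
  "last_entry correct r v = Max {entry_time r i v |i. i \<in> correct \<and> enters r i v}"

text \<open>The second conjunct says that a process enters a view at most once, so that
  \<open>entry_time\<close> is well defined. Since every correct process enters every view from \<open>V\<close> on,
  \<open>first_entry\<close> and \<open>last_entry\<close> are only used where they are a minimum and a maximum of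
  nonempty finite sets.\<close>

definition synchronizer_spec ::
    "proc set \<Rightarrow> real \<Rightarrow> view \<Rightarrow> real \<Rightarrow> (view \<Rightarrow> real) \<Rightarrow> ('x, 'h) run \<Rightarrow> bool" where
  "synchronizer_spec correct GST V d F r \<longleftrightarrow>
     1 \<le> V \<and>
     (\<forall>i\<in>correct. \<forall>v k k'. enters_at r i v k \<longrightarrow> enters_at r i v k' \<longrightarrow> k = k') \<and>
     (\<forall>i\<in>correct. \<forall>v v'. v < v' \<longrightarrow> enters r i v \<longrightarrow> enters r i v' \<longrightarrow>
        entry_time r i v < entry_time r i v') \<and>
     GST \<le> first_entry correct r V \<and>
     (\<forall>i\<in>correct. \<forall>v\<ge>V. enters r i v) \<and>
     (\<forall>v\<ge>V. last_entry correct r v \<le> first_entry correct r v + d) \<and>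
     (\<forall>v\<ge>V. first_entry correct r v + F v \<le> first_entry correct r (v + 1))"

definition decides :: "('x, 'h) run \<Rightarrow> proc \<Rightarrow> bool" where
  "decides r i \<longleftrightarrow> (\<exists>k x. actor r k = i \<and> event r k = Decide x)"

end

theory Submission
  imports Defs
begin

text \<open>Since \<open>F\<close> is unbounded and leaders rotate, some view \<open>v \<ge> V\<close> has a correct leader and
  satisfies \<open>F v > 6 \<delta>\<close>. Let \<open>t\<close> be the time of the first correct entry into it. By
  \<open>t + 2 \<delta>\<close> all correct processes are in \<open>v\<close>, and none leaves before \<open>t + F v\<close>. With one
  \<open>\<delta>\<close> for each message exchange, the leader has proposed by \<open>t + 3 \<delta>\<close>, all correct
  processes have voted by \<open>t + 4 \<delta>\<close>, are prepared by \<open>t + 5 \<delta>\<close>, and decide by \<open>t + 6 \<delta>\<close>.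
  Zero processing time enters as follows: at the last step not later than a given time no
  handler is pending, so whatever is enabled has already been executed. The leader cannot
  be blocked by a stale lock, because it waits for all correct NEWLEADER messages if
  necessary, and its proposal is valid because any certified value was voted for by a
  correct process.\<close>

section \<open>Single local steps: what they send and how they change the state and the
  buffer\<close>

lemma msg_in_parts: "m \<in> msg_parts m"
proof -
  have "NewLeaderMsg p \<in> newleader_parts p" for p :: "('a, 'b) newleader signed"
    by (cases p rule: newleader_parts.cases) auto
  then show ?thesis
    by (cases m rule: msg_parts.cases) auto
qed

text \<open>The view of the message is compared with the state after the step because NEWLEADER
  messages, and the proposal for view 1, are sent while their view is being entered. No other
  handler changes \<open>curr_view\<close>.\<close>

lemma local_step_sent:
  assumes "local_step f valid hash myval i s e s' S" "(a, b, m) \<in> S"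
  shows "a = i \<and> msg_signer m = i \<and> msg_view m = curr_view s'"
  using assms
proof cases
  case (vote p v x M)
  then have "p = Signed (signer p) (PROPOSE v x M)"
    by (metis signed.collapse)
  then have "v = curr_view s"
    using vote by (metis can_vote_def msg_view.simps(2))
  then show ?thesis
    using vote assms(2) by (auto simp: to_all_def)
qed (use assms(2) in \<open>auto simp: new_leader_packet_def to_all_def enter_view_def\<close>)

lemma local_step_sent_newleader:
  assumes "local_step f valid hash myval i s e s' S" "(a, b, NewLeaderMsg m) \<in> S"
  shows "\<exists>v. e = NewView v \<and>
    m = Signed i (NEWLEADER v (locked_view s) (prepared_val s) (cert s))"
  using assms by cases (auto simp: new_leader_packet_def to_all_def)

text \<open>The second alternative is the proposal of the view-1 optimization, made on entry and
  carrying no NEWLEADER messages.\<close>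

lemma local_step_sent_propose:
  assumes "local_step f valid hash myval i s e s' S" "(a, b, ProposeMsg m) \<in> S"
  shows "(\<exists>x M. e = Propose x M \<and> can_propose f hash myval i s x M \<and> curr_view s' = curr_view s \<and>
            m = Signed i (PROPOSE (curr_view s) x M) \<and> Proposing \<in> ran s') \<or>
         m = Signed i (PROPOSE 1 (myval i) {})"
  using assms by cases (auto simp: new_leader_packet_def to_all_def)

lemma local_step_sent_prepared:
  assumes "local_step f valid hash myval i s e s' S" "(a, b, PreparedMsg m) \<in> S"
  shows "\<exists>j x M. can_vote f valid hash s (Signed j (PROPOSE (curr_view s) x M)) \<and>
    m = Signed i (PREPARED (curr_view s) (hash x)) \<and> curr_view s' = curr_view s \<and>
    curr_val s' = Some x \<and> voted s' = Some True"
  using assms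
proof cases
  case (vote p v x M)
  then have p: "p = Signed (signer p) (PROPOSE v x M)"
    by (metis signed.collapse)
  then have "v = curr_view s"
    using vote by (metis can_vote_def msg_view.simps(2))
  with vote p assms(2) show ?thesis
    by (intro exI[of _ "signer p"] exI[of _ x] exI[of _ M]) (auto simp: to_all_def)
qed (use assms(2) in \<open>auto simp: new_leader_packet_def to_all_def\<close>)

lemma local_step_sent_committed:
  assumes "local_step f valid hash myval i s e s' S" "(a, b, CommittedMsg m) \<in> S"
  shows "\<exists>x. m = Signed i (COMMITTED (curr_view s) (hash x)) \<and> voted s = Some True \<and>
    curr_val s = Some x"
  using assms by cases (auto simp: new_leader_packet_def to_all_def can_prepare_def)

lemma local_step_new_view:
  assumes "local_step f valid hash myval i s (NewView v) s' S"
  shows "0 < v" "curr_view s' = v"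
  using assms by (cases; simp add: enter_view_def)+

lemma local_step_same_view:
  assumes "local_step f valid hash myval i s e s' S" "\<And>v. e \<noteq> NewView v"
  shows "curr_view s' = curr_view s" "ran s \<subseteq> ran s'"
    and "voted s = Some True \<Longrightarrow> voted s' = Some True \<and> curr_val s' = curr_val s"
  using assms by (cases; auto simp: can_vote_def)+

text \<open>Entering a view loses nothing: what leaves the buffer becomes available to the
  handlers.\<close>

lemma enter_view_keeps:
  assumes "m \<in> received s \<or> buffer s slot = Some m"
  shows "m \<in> received (enter_view v s) \<or> v < msg_view m \<and> buffer (enter_view v s) slot = Some m"
  using assms by (cases "v < msg_view m") (auto simp: enter_view_def simp del: split_paired_Ex)

text \<open>With \<open>buffer_insert_mono\<close>, this shows that a message can be refused or
  displaced only in favour of one of the same slot with at least its view.\<close>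

lemma buffer_insert_own:
  assumes "buffer_insert b m b'"
  shows "\<exists>m'. b' (msg_kind m, msg_signer m) = Some m' \<and> msg_view m \<le> msg_view m'"
  using assms unfolding buffer_insert_def Let_def by (auto split: option.splits if_splits)

lemma buffer_insert_mono:
  assumes "buffer_insert b m b'" "b slot = Some m0"
  shows "\<exists>m'. b' slot = Some m' \<and> msg_view m0 \<le> msg_view m'"
  using assms unfolding buffer_insert_def Let_def by (auto split: option.splits if_splits)

lemma finite_procs: "finite (procs f)"
  by (simp add: procs_def)

lemma finite_quorum: "quorum f Q \<Longrightarrow> finite Q"
  unfolding quorum_def using finite_procs finite_subset by blast

section \<open>Runs: quorums, the clock and single steps\<close>

locale pbft =
  fixes f :: nat
    and correct :: "proc set"
    and valid :: "'x \<Rightarrow> bool"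
    and hash :: "'x \<Rightarrow> 'h"
    and myval :: "proc \<Rightarrow> 'x"
    and r :: "('x, 'h) run"
  assumes correct_procs: "correct \<subseteq> procs f"
    and few_faulty: "card (procs f - correct) \<le> f"
    and inj_hash: "inj hash"
    and valid_myval: "i \<in> correct \<Longrightarrow> valid (myval i)"
    and run: "pbft_run f correct valid hash myval r"
begin

lemma finite_correct: "finite correct"
  using correct_procs finite_procs finite_subset by blast

text \<open>Of the \<open>3 * f + 1\<close> processes at most \<open>f\<close> are faulty, which
  leaves at least \<open>2 * f + 1\<close> correct ones.\<close>

lemma correct_quorum_exists: "\<exists>Q\<subseteq>correct. quorum f Q"
proof -
  have "card (procs f) = card correct + card (procs f - correct)"
    using card_Diff_subset[OF finite_correct correct_procs]
      card_mono[OF finite_procs correct_procs] by simp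
  then have "2 * f + 1 \<le> card correct"
    using few_faulty by (simp add: procs_def)
  then obtain Q where "Q \<subseteq> correct" "card Q = 2 * f + 1"
    by (meson obtain_subset_with_card_n)
  then show ?thesis
    using correct_procs by (auto simp: quorum_def)
qed

lemma quorum_meets_correct:
  assumes "quorum f Q"
  shows "\<exists>i\<in>Q. i \<in> correct"
proof (rule ccontr)
  assume "\<not> (\<exists>i\<in>Q. i \<in> correct)"
  then have "Q \<subseteq> procs f - correct"
    using assms by (auto simp: quorum_def)
  then have "card Q \<le> f"
    using few_faulty finite_procs card_mono[of "procs f - correct" Q] by simp
  then show False
    using assms by (simp add: quorum_def)
qed

lemma mono_clock: "k \<le> k' \<Longrightarrow> clock r k \<le> clock r k'"
  using run by (auto simp: pbft_run_def mono_def)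

lemma init: "i \<in> correct \<Longrightarrow> state r 0 i = init_state"
  using run by (auto simp: pbft_run_def)

lemma correct_step:
  "actor r k \<in> correct \<Longrightarrow>
    local_step f valid hash myval (actor r k) (state r k (actor r k)) (event r k)
      (state r (Suc k) (actor r k)) (sent r k)"
  using run by (auto simp: pbft_run_def)

lemma faulty_step: "actor r k \<notin> correct \<Longrightarrow> faulty_step correct r k"
  using run by (auto simp: pbft_run_def)

lemma receive_sent:
  "actor r k \<in> correct \<Longrightarrow> event r k = Receive j m \<Longrightarrow> \<exists>k'<k. (j, actor r k, m) \<in> sent r k'"
  using run by (auto simp: pbft_run_def)

lemma step_cases [consumes 1, case_names other own]:
  assumes "i \<in> correct"
  obtains "actor r k \<noteq> i" "state r (Suc k) i = state r k i"
  | "actor r k = i" "local_step f valid hash myval i (state r k i) (event r k)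
      (state r (Suc k) i) (sent r k)"
  using run assms correct_step unfolding pbft_run_def by metis

text \<open>Several steps may share one time. The state after the last step up to time
  \<open>t\<close> is where zero processing time can be used: the clock advances strictly right
  after that step, so no correct process has a handler pending.\<close>

definition last_step :: "real \<Rightarrow> nat \<Rightarrow> bool" where
  "last_step t k \<longleftrightarrow> clock r k \<le> t \<and> t < clock r (Suc k)"

text \<open>The clock diverges, so some step lies beyond \<open>t\<close>; the predecessor of the
  first such step after \<open>k0\<close> is as required.\<close>

lemma last_step_exists:
  assumes "clock r k0 \<le> t"
  shows "\<exists>k. last_step t k"
proof -
  have "filterlim (clock r) at_top sequentially"
    using run by (simp add: pbft_run_def)
  then have "\<forall>\<^sub>F k in sequentially. t < clock r k"
    by (simp add: filterlim_at_top_dense)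
  then obtain N where N: "t < clock r (k0 + N)"
    by (metis eventually_sequentially le_add2)
  then have ex: "\<exists>n. t < clock r (k0 + n)"
    by blast
  define n where "n = (LEAST n. t < clock r (k0 + n))"
  have n: "t < clock r (k0 + n)" "\<And>n'. n' < n \<Longrightarrow> clock r (k0 + n') \<le> t"
    using LeastI_ex[OF ex] not_less_Least unfolding n_def by fastforce+
  then obtain n' where "n = Suc n'"
    using assms by (cases n) auto
  then show ?thesis
    using n by (auto simp: last_step_def intro!: exI[of _ "k0 + n'"])
qed

lemma last_step_max: "last_step t k \<Longrightarrow> clock r k' \<le> t \<Longrightarrow> k' \<le> k"
  using mono_clock[of "Suc k" k'] by (force simp: last_step_def)

lemma last_step_not_pending:
  "last_step t k \<Longrightarrow> i \<in> correct \<Longrightarrow> \<not> handler_pending f valid hash myval i (state r (Suc k) i)"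
  using run by (auto simp: last_step_def pbft_run_def)

section \<open>Authenticity\<close>

lemma sent_by_actor:
  assumes "(a, b, m) \<in> sent r k"
  shows "a = actor r k"
proof (cases "actor r k \<in> correct")
  case True
  show ?thesis
    using local_step_sent[OF correct_step[OF True] assms] by simp
next
  case False
  then show ?thesis
    using faulty_step assms by (auto simp: faulty_step_def)
qed

lemma sent_correct:
  assumes "(i, b, m) \<in> sent r k" "i \<in> correct"
  shows "local_step f valid hash myval i (state r k i) (event r k) (state r (Suc k) i) (sent r k)"
    and "msg_signer m = i" "msg_view m = curr_view (state r (Suc k) i)"
  using sent_by_actor[OF assms(1)] correct_step[of k] assms local_step_sent by metis+

text \<open>A message enters the local state only by a \<open>Receive\<close> event, which needs an
  earlier sending; entering a view merely moves messages out of the buffer.\<close>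

lemma held_sent:
  assumes "i \<in> correct"
  shows "m \<in> received (state r k i) \<or> buffer (state r k i) slot = Some m \<Longrightarrow>
      \<exists>k'<k. \<exists>a b. (a, b, m) \<in> sent r k'"
proof (induction k arbitrary: m slot)
  case 0
  then show ?case
    by (simp add: init[OF assms] init_state_def)
next
  case (Suc k)
  let ?s = "state r k i"
  show ?case
    using assms
  proof (cases rule: step_cases[where k=k])
    case other
    then show ?thesis
      using Suc by (metis less_Suc_eq)
  next
    case own
    have "m \<in> received ?s \<or> (\<exists>slot. buffer ?s slot = Some m) \<or> (\<exists>j. event r k = Receive j m)"
      using own(2)
    proof cases
      case (receive_buffered m' b j)
      then have "b = buffer ?s \<or> b = (buffer ?s)((msg_kind m', msg_signer m') := Some m')"
        by (auto simp: buffer_insert_def Let_def split: option.splits if_splits)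
      then show ?thesis
        using Suc.prems receive_buffered
        by (auto simp del: split_paired_Ex split: if_splits)
    qed (use Suc.prems in \<open>auto simp: enter_view_def simp del: split_paired_Ex
        split: option.splits if_splits\<close>)
    then show ?thesis
      using Suc.IH receive_sent[of k] own(1) assms by (metis less_Suc_eq)
  qed
qed

lemma buffer_slot:
  assumes "i \<in> correct"
  shows "buffer (state r k i) slot = Some m \<Longrightarrow> slot = (msg_kind m, msg_signer m)"
proof (induction k)
  case 0
  then show ?case
    by (simp add: init[OF assms] init_state_def)
next
  case (Suc k)
  show ?case
    using assms
  proof (cases rule: step_cases[where k=k])
    case own
    from own(2) show ?thesis
      by cases (use Suc in \<open>auto simp: enter_view_def buffer_insert_def Let_def
          split: option.splits if_splits\<close>)
  qed (use Suc in auto)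
qed

text \<open>Makes the votes inside a NEWLEADER message of a correct process traceable: they were
  received before, hence sent before.\<close>

lemma cert_received:
  assumes "i \<in> correct"
  shows "cert (state r k i) = Some C \<Longrightarrow> PreparedMsg ` C \<subseteq> received (state r k i)"
proof (induction k)
  case 0
  then show ?case
    by (simp add: init[OF assms] init_state_def)
next
  case (Suc k)
  show ?case
    using assms
  proof (cases rule: step_cases[where k=k])
    case own
    from own(2) show ?thesis
      by cases (use Suc in \<open>auto simp: enter_view_def can_prepare_def\<close>)
  qed (use Suc in auto)
qed

text \<open>Strong induction on the sending step. A faulty sender can only reuse signatures of
  correct processes. A correct sender signs the outer message itself, and every further part belongs
  to a message it has received, which was sent strictly earlier.\<close>

lemma authentic:
  assumes "(a, b, m) \<in> sent r k" "m' \<in> msg_parts m" "msg_signer m' \<in> correct"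
  shows "\<exists>k'\<le>k. \<exists>b'. (msg_signer m', b', m') \<in> sent r k'"
  using assms
proof (induction k arbitrary: a b m rule: less_induct)
  case (less k)
  show ?case
  proof (cases "actor r k \<in> correct")
    case False
    then have "\<exists>k'<k. \<exists>b'. (msg_signer m', b', m') \<in> sent r k'"
      using faulty_step[OF False] less.prems unfolding faulty_step_def by blast
    then show ?thesis
      using less_imp_le by blast
  next
    case True
    let ?i = "actor r k"
    have a: "a = ?i"
      using sent_by_actor less.prems(1) by simp
    have signer: "msg_signer m = ?i"
      using sent_correct(2) a less.prems(1) True by blast
    have held: ?thesis if "m'' \<in> received (state r k ?i)" "m' \<in> msg_parts m''" for m''
      using held_sent[OF True, of m'' k] that less.IH less.prems(3) by (meson less_imp_le order_trans)
    note step = correct_step[OF True]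
    have "m' = m \<or> (\<exists>m''\<in>received (state r k ?i). m' \<in> msg_parts m'')"
    proof (cases m)
      case (NewLeaderMsg p)
      then obtain v where p: "p = Signed ?i (NEWLEADER v (locked_view (state r k ?i))
          (prepared_val (state r k ?i)) (cert (state r k ?i)))"
        using local_step_sent_newleader[OF step] less.prems(1) by blast
      show ?thesis
      proof (cases "cert (state r k ?i)")
        case None
        then show ?thesis
          using NewLeaderMsg p less.prems(2) by simp
      next
        case (Some C)
        then show ?thesis
          using NewLeaderMsg p less.prems(2) cert_received[OF True Some] msg_in_parts by auto
      qed
    next
      case (ProposeMsg p)
      then consider x M where "can_propose f hash myval ?i (state r k ?i) x M"
          "p = Signed ?i (PROPOSE (curr_view (state r k ?i)) x M)"
        | "p = Signed ?i (PROPOSE 1 (myval ?i) {})"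
        using local_step_sent_propose[OF step] less.prems(1) by blast
      then show ?thesis
      proof cases
        case 1
        then have "NewLeaderMsg ` M \<subseteq> received (state r k ?i)"
          by (simp add: can_propose_def)
        moreover have "m' = m \<or> (\<exists>q\<in>M. m' \<in> msg_parts (NewLeaderMsg q))"
          using 1(2) ProposeMsg less.prems(2) by auto
        ultimately show ?thesis
          by blast
      qed (use ProposeMsg less.prems(2) in auto)
    qed (use less.prems(2) in auto)
    then show ?thesis
    proof
      assume "m' = m"
      then show ?thesis
        using less.prems(1) a signer by auto
    qed (use held in blast)
  qed
qed

lemma held_authentic:
  assumes "i \<in> correct" "m \<in> received (state r k i) \<or> buffer (state r k i) slot = Some m"
    "m' \<in> msg_parts m" "msg_signer m' \<in> correct"
  shows "\<exists>k'<k. \<exists>b. (msg_signer m', b, m') \<in> sent r k'"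
  using held_sent[OF assms(1,2)] authentic[OF _ assms(3,4)] by (meson order_le_less_trans)

text \<open>A prepared certificate contains a vote of a correct process, which has checked the value.\<close>

lemma prepared_valid:
  assumes "i \<in> correct" "NewLeaderMsg (Signed j (NEWLEADER v u (Some y) (Some D))) \<in> received (state r k i)"
    and "is_prepared f D u (hash y)"
  shows "valid y"
proof -
  obtain Q where Q: "quorum f Q" "D = (\<lambda>j. Signed j (PREPARED u (hash y))) ` Q"
    using assms(3) by (auto simp: is_prepared_def)
  obtain p where p: "p \<in> Q" "p \<in> correct"
    using quorum_meets_correct[OF Q(1)] by blast
  let ?m = "PreparedMsg (Signed p (PREPARED u (hash y)))"
  have "?m \<in> msg_parts (NewLeaderMsg (Signed j (NEWLEADER v u (Some y) (Some D))))"
    using Q(2) p(1) by auto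
  then obtain k' b where sent: "(p, b, ?m) \<in> sent r k'"
    using held_authentic[OF assms(1) disjI1[OF assms(2)], of ?m] p(2) by auto
  obtain l x M where vote: "can_vote f valid hash (state r k' p)
        (Signed l (PROPOSE (curr_view (state r k' p)) x M))" and "hash x = hash y"
    using local_step_sent_prepared[OF sent_correct(1)[OF sent p(2)] sent] by auto
  then have "x = y"
    using inj_hash by (simp add: inj_eq)
  then show ?thesis
    using vote by (auto simp: can_vote_def)
qed

text \<open>Only \<open>Prepare\<close> changes the lock, and it stores the view, the value and a
  matching certificate together. This is why NEWLEADER messages of correct processes pass
  \<open>valid_new_leader\<close>.\<close>

lemma locked_certified:
  assumes "i \<in> correct"
  shows "locked_view (state r k i) \<noteq> 0 \<Longrightarrow>
    \<exists>y D. prepared_val (state r k i) = Some y \<and> cert (state r k i) = Some D \<and>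
      is_prepared f D (locked_view (state r k i)) (hash y)"
proof (induction k)
  case 0
  then show ?case
    by (simp add: init[OF assms] init_state_def)
next
  case (Suc k)
  show ?case
    using assms
  proof (cases rule: step_cases[where k=k])
    case own
    from own(2) show ?thesis
      by cases (use Suc in \<open>auto simp: enter_view_def can_prepare_def\<close>)
  qed (use Suc in auto)
qed

text \<open>The leader has checked everything that the voters check except validity of the value.
  That value is either its own, or certified and then covered by
  \<open>prepared_valid\<close>.\<close>

lemma propose_safe:
  assumes i: "i \<in> correct" and propose: "can_propose f hash myval i (state r k i) x M"
  shows "safe_proposal f valid hash (Signed i (PROPOSE (curr_view (state r k i)) x M))"
proof -
  let ?v = "curr_view (state r k i)"
  obtain Q view val where Q: "new_leader_quorum f hash ?v Q view val M"
      "if Max (view ` Q) \<noteq> 0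
       then \<exists>j\<in>Q. view j = Max (view ` Q) \<and> val j = Some x
       else x = myval i"
    and M: "i = leader f ?v" "NewLeaderMsg ` M \<subseteq> received (state r k i)"
    using propose by (auto simp: can_propose_def)
  have fin: "finite Q"
    using Q(1) finite_quorum by (auto simp: new_leader_quorum_def)
  obtain cert where cert: "M = (\<lambda>j. Signed j (NEWLEADER ?v (view j) (val j) (cert j))) ` Q"
      "\<forall>m\<in>M. valid_new_leader f hash m"
    using Q(1) by (auto simp: new_leader_quorum_def)
  have "valid x"
  proof (cases "Max (view ` Q) = 0")
    case True
    then show ?thesis
      using Q(2) i valid_myval by simp
  next
    case False
    then obtain j where j: "j \<in> Q" "view j \<noteq> 0" "val j = Some x"
      using Q(2) by auto
    then obtain D where D: "cert j = Some D" "is_prepared f D (view j) (hash x)"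
      using cert by fastforce
    have "NewLeaderMsg (Signed j (NEWLEADER ?v (view j) (val j) (cert j))) \<in> received (state r k i)"
      using M(2) cert(1) j(1) by auto
    then show ?thesis
      using prepared_valid[OF i] D j by metis
  qed
  \<comment> \<open>The leader tests whether the maximum is nonzero, the voters whether some view is
    nonzero; this bridges the two forms.\<close>
  moreover have "Max (view ` Q) \<noteq> 0" if "j \<in> Q" "view j \<noteq> 0" for j
  proof -
    have "view j \<le> Max (view ` Q)"
      using fin that(1) by simp
    then show ?thesis
      using that(2) by linarith
  qed
  then have "(\<exists>j\<in>Q. view j \<noteq> 0) \<longrightarrow> (\<exists>j\<in>Q. view j = Max (view ` Q) \<and> val j = Some x)"
    using Q(2) by metis
  ultimately show ?thesis
    using Q(1) M(1) unfolding safe_proposal.simps by blast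
qed

section \<open>What the state of a process tells about its past\<close>

text \<open>The undefined value survives only until the first view is entered. Later, a process that
  has not voted has \<open>Some False\<close>, so excluding that value yields a vote.\<close>

lemma voted_defined:
  assumes "i \<in> correct"
  shows "curr_view (state r k i) \<noteq> 0 \<Longrightarrow> voted (state r k i) \<noteq> None"
proof (induction k)
  case 0
  then show ?case
    by (simp add: init[OF assms] init_state_def)
next
  case (Suc k)
  show ?case
    using assms
  proof (cases rule: step_cases[where k=k])
    case own
    from own(2) show ?thesis
      by cases (use Suc in \<open>auto simp: enter_view_def\<close>)
  qed (use Suc in auto)
qed

text \<open>As \<open>ran\<close> is emptied on every entry, the record stems from the current view.
  View 1 is excluded because its leader gets the record on entry, without executing
  \<open>Propose\<close>.\<close>

lemma propose_history:
  assumes "i \<in> correct"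
  shows "Proposing \<in> ran (state r k i) \<Longrightarrow> curr_view (state r k i) \<noteq> 1 \<Longrightarrow>
    \<exists>k'<k. \<exists>x M. can_propose f hash myval i (state r k' i) x M \<and>
      curr_view (state r k' i) = curr_view (state r k i) \<and>
      to_all f i (ProposeMsg (Signed i (PROPOSE (curr_view (state r k i)) x M))) \<subseteq> sent r k'"
proof (induction k)
  case 0
  then show ?case
    by (simp add: init[OF assms] init_state_def)
next
  case (Suc k)
  show ?case
    using assms
  proof (cases rule: step_cases[where k=k])
    case own
    from own(2) show ?thesis
      by cases (use Suc in \<open>auto simp: enter_view_def Ex_less_Suc\<close>)
  qed (use Suc in \<open>auto simp: Ex_less_Suc\<close>)
qed

lemma vote_history:
  assumes "i \<in> correct"
  shows "voted (state r k i) = Some True \<Longrightarrow>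
    \<exists>k'<k. \<exists>l x M.
      can_vote f valid hash (state r k' i) (Signed l (PROPOSE (curr_view (state r k i)) x M)) \<and>
      curr_val (state r k i) = Some x \<and>
      to_all f i (PreparedMsg (Signed i (PREPARED (curr_view (state r k i)) (hash x)))) \<subseteq> sent r k'"
proof (induction k)
  case 0
  then show ?case
    by (simp add: init[OF assms] init_state_def)
next
  case (Suc k)
  show ?case
    using assms
  proof (cases rule: step_cases[where k=k])
    case own
    from own(2) show ?thesis
    proof cases
      case (vote p v x M)
      then have p: "p = Signed (signer p) (PROPOSE v x M)"
        by (metis signed.collapse)
      then have "v = curr_view (state r k i)"
        using vote by (metis can_vote_def msg_view.simps(2))
      with vote p show ?thesis
        by (intro exI[of _ k] conjI exI[of _ "signer p"] exI[of _ x] exI[of _ M]) auto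
    qed (use Suc in \<open>auto simp: enter_view_def Ex_less_Suc\<close>)
  qed (use Suc in \<open>auto simp: Ex_less_Suc\<close>)
qed

text \<open>The conjunct on \<open>voted\<close> carries the induction: it rules out a further vote
  in this view, which would overwrite \<open>curr_val\<close>.\<close>

lemma prepare_history:
  assumes "i \<in> correct"
  shows "Preparing \<in> ran (state r k i) \<Longrightarrow>
    locked_view (state r k i) = curr_view (state r k i) \<and> voted (state r k i) = Some True \<and>
    (\<exists>k'<k. \<exists>x. curr_val (state r k i) = Some x \<and>
      to_all f i (CommittedMsg (Signed i (COMMITTED (curr_view (state r k i)) (hash x)))) \<subseteq> sent r k')"
proof (induction k)
  case 0
  then show ?case
    by (simp add: init[OF assms] init_state_def)
next
  case (Suc k)
  show ?case
    using assms
  proof (cases rule: step_cases[where k=k])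
    case own
    from own(2) show ?thesis
      by cases (use Suc in \<open>auto simp: enter_view_def Ex_less_Suc can_prepare_def can_vote_def\<close>)
  qed (use Suc in \<open>auto simp: Ex_less_Suc\<close>)
qed

lemma decide_history:
  assumes "i \<in> correct"
  shows "Deciding \<in> ran (state r k i) \<Longrightarrow> decides r i"
proof (induction k)
  case 0
  then show ?case
    by (simp add: init[OF assms] init_state_def)
next
  case (Suc k)
  show ?case
    using assms
  proof (cases rule: step_cases[where k=k])
    case own
    from own(2) show ?thesis
      by cases (use Suc own(1) in \<open>auto simp: enter_view_def decides_def\<close>)
  qed (use Suc in auto)
qed

end

locale synchronized_pbft = pbft f correct valid hash myval r
  for f :: nat
    and correct :: "proc set"
    and valid :: "'x \<Rightarrow> bool"
    and hash :: "'x \<Rightarrow> 'h"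
    and myval :: "proc \<Rightarrow> 'x"
    and r :: "('x, 'h) run" +
  fixes GST \<delta> :: real
    and F :: "view \<Rightarrow> real"
    and V :: view
  assumes partial_synchrony: "partially_synchronous correct GST \<delta> r"
    and mono_F: "mono F"
    and F_0: "F 0 = 0"
    and synchronizer: "synchronizer_spec correct GST V (2 * \<delta>) F r"
begin

section \<open>Views\<close>

lemma enters_once:
  "i \<in> correct \<Longrightarrow> enters_at r i v k \<Longrightarrow> enters_at r i v k' \<Longrightarrow> k = k'"
  using synchronizer unfolding synchronizer_spec_def by blast

lemma entry_time_eq: "i \<in> correct \<Longrightarrow> enters_at r i v k \<Longrightarrow> entry_time r i v = clock r k"
  unfolding entry_time_def using enters_once by (metis the_equality)

lemma entry_time_mono:
  "i \<in> correct \<Longrightarrow> v < v' \<Longrightarrow> enters r i v \<Longrightarrow> enters r i v' \<Longrightarrow>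
    entry_time r i v < entry_time r i v'"
  using synchronizer unfolding synchronizer_spec_def by blast

text \<open>Transfers (P1) from entry times to step numbers, using that the clock never runs
  backwards.\<close>

lemma views_increase:
  assumes "i \<in> correct" "enters_at r i v k" "enters_at r i v' k'" "k < k'"
  shows "v < v'"
proof (rule ccontr)
  assume "\<not> v < v'"
  moreover have "v \<noteq> v'"
    using enters_once assms by blast
  ultimately have "clock r k' < clock r k"
    using entry_time_mono[of i v' v] assms by (auto simp: entry_time_eq enters_def)
  then show False
    using mono_clock[of k k'] assms(4) by simp
qed

lemma current_view_entered:
  assumes "i \<in> correct"
  shows "curr_view (state r k i) \<noteq> 0 \<Longrightarrow> \<exists>k0<k. enters_at r i (curr_view (state r k i)) k0"
proof (induction k)
  case 0
  then show ?case
    by (simp add: init[OF assms] init_state_def)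
next
  case (Suc k)
  show ?case
    using assms
  proof (cases rule: step_cases[where k=k])
    case own
    show ?thesis
    proof (cases "\<exists>v. event r k = NewView v")
      case True
      then show ?thesis
        using own local_step_new_view(2) by (fastforce simp: enters_at_def)
    next
      case False
      then show ?thesis
        using Suc local_step_same_view(1)[OF own(2)] by (auto simp: Ex_less_Suc)
    qed
  qed (use Suc in \<open>auto simp: Ex_less_Suc\<close>)
qed

lemma entered_le_current_view:
  assumes "i \<in> correct" "enters_at r i v k0"
  shows "k0 < k \<Longrightarrow> v \<le> curr_view (state r k i)"
proof (induction k)
  case (Suc k)
  show ?case
    using assms(1)
  proof (cases rule: step_cases[where k=k])
    case other
    then have "k0 \<noteq> k"
      using assms(2) by (auto simp: enters_at_def)
    then show ?thesis
      using Suc other by simp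
  next
    case own
    show ?thesis
    proof (cases "\<exists>v'. event r k = NewView v'")
      case True
      then obtain v' where v': "event r k = NewView v'"
        by blast
      then have "curr_view (state r (Suc k) i) = v'"
        using own(2) local_step_new_view(2) by metis
      moreover have "enters_at r i v' k"
        using v' own(1) by (simp add: enters_at_def)
      moreover have "k0 = k \<Longrightarrow> v = v'"
        using assms(2) v' by (simp add: enters_at_def)
      ultimately show ?thesis
        using Suc.prems views_increase[OF assms, of v' k] by (cases "k0 = k") auto
    next
      case False
      then have "k0 \<noteq> k"
        using assms(2) by (auto simp: enters_at_def)
      then show ?thesis
        using Suc False local_step_same_view(1)[OF own(2)] by auto
    qed
  qed
qed simp

lemma curr_view_mono:
  assumes "i \<in> correct" "k \<le> k'"
  shows "curr_view (state r k i) \<le> curr_view (state r k' i)"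
proof (cases "curr_view (state r k i) = 0")
  case False
  then show ?thesis
    using current_view_entered[OF assms(1)] entered_le_current_view[OF assms(1)] assms(2)
    by (meson order_less_le_trans)
qed simp

lemma entering_new_view:
  assumes "i \<in> correct" "enters_at r i v k"
  shows "curr_view (state r k i) < v" "curr_view (state r (Suc k) i) = v"
proof -
  have step: "local_step f valid hash myval i (state r k i) (NewView v) (state r (Suc k) i) (sent r k)"
    using correct_step[of k] assms by (simp add: enters_at_def)
  then show "curr_view (state r (Suc k) i) = v"
    by (rule local_step_new_view)
  show "curr_view (state r k i) < v"
  proof (cases "curr_view (state r k i) = 0")
    case True
    then show ?thesis
      using local_step_new_view(1)[OF step] by simp
  next
    case False
    then show ?thesis
      using current_view_entered[OF assms(1)] views_increase[OF assms(1) _ assms(2)] by blast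
  qed
qed

text \<open>A lock is always set to the current view, and views only grow. Together with
  \<open>entering_new_view\<close> this gives the strict inequality demanded of NEWLEADER
  messages.\<close>

lemma locked_le_current_view:
  assumes "i \<in> correct"
  shows "locked_view (state r k i) \<le> curr_view (state r k i)"
proof (induction k)
  case 0
  then show ?case
    by (simp add: init[OF assms] init_state_def)
next
  case (Suc k)
  show ?case
    using assms
  proof (cases rule: step_cases[where k=k])
    case own
    have "curr_view (state r k i) \<le> curr_view (state r (Suc k) i)"
      using curr_view_mono[OF assms] by simp
    with own(2) Suc show ?thesis
      by cases (auto simp: enter_view_def)
  qed (use Suc in auto)
qed

text \<open>Equal views at both ends exclude any entry in between, and only an entry erases
  \<open>ran\<close> or allows a second vote.\<close>

lemma same_view_persistent:
  assumes "i \<in> correct" "k \<le> k'" "curr_view (state r k' i) = curr_view (state r k i)"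
  shows "ran (state r k i) \<subseteq> ran (state r k' i) \<and>
    (voted (state r k i) = Some True \<longrightarrow>
      voted (state r k' i) = Some True \<and> curr_val (state r k' i) = curr_val (state r k i))"
  using assms(2,3)
proof (induction k' rule: dec_induct)
  case (step n)
  have eq: "curr_view (state r n i) = curr_view (state r k i)"
    using curr_view_mono[OF assms(1) step.hyps(1)] curr_view_mono[OF assms(1), of n "Suc n"]
      step.prems by simp
  show ?case
    using assms(1)
  proof (cases rule: step_cases[where k=n])
    case own
    have "event r n \<noteq> NewView v" for v
      using entering_new_view[OF assms(1), of v n] own(1) eq step.prems by (auto simp: enters_at_def)
    then show ?thesis
      using local_step_same_view[OF own(2)] step.IH[OF eq] by auto
  qed (use step.IH[OF eq] in auto)
qed simp

text \<open>A view is entered once, proposed in once and voted in once, which settles three kinds of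
  messages. Excluding view 1 ensures that each proposal comes from a \<open>Propose\<close>
  event.\<close>

lemma sent_unique_ordered:
  assumes i: "i \<in> correct" and sent: "(i, b, m) \<in> sent r k" "(i, b', m') \<in> sent r k'"
    and same: "msg_kind m = msg_kind m'" "msg_view m = msg_view m'" "msg_view m \<noteq> 1"
    and le: "k \<le> k'"
  shows "m = m'"
proof -
  note step = sent_correct(1)[OF sent(1) i] and step' = sent_correct(1)[OF sent(2) i]
  have view: "curr_view (state r (Suc k) i) = curr_view (state r (Suc k') i)"
    using sent_correct(3)[OF sent(1) i] sent_correct(3)[OF sent(2) i] same by simp
  show ?thesis
  proof (cases m)
    case (NewLeaderMsg p)
    then obtain p' where p': "m' = NewLeaderMsg p'"
      using same(1) by (cases m') auto
    obtain v where v: "event r k = NewView v"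
        "p = Signed i (NEWLEADER v (locked_view (state r k i)) (prepared_val (state r k i)) (cert (state r k i)))"
      using local_step_sent_newleader[OF step] sent(1) NewLeaderMsg by blast
    obtain v' where v': "event r k' = NewView v'"
        "p' = Signed i (NEWLEADER v' (locked_view (state r k' i)) (prepared_val (state r k' i)) (cert (state r k' i)))"
      using local_step_sent_newleader[OF step'] sent(2) p' by blast
    have eq: "v = v'"
      using same(2) NewLeaderMsg p' v v' by simp
    moreover have "k = k'"
      using enters_once[OF i, of v k k'] v v' eq sent_by_actor sent by (auto simp: enters_at_def)
    ultimately show ?thesis
      using NewLeaderMsg p' v v' by simp
  next
    case (ProposeMsg p)
    then obtain p' where p': "m' = ProposeMsg p'"
      using same(1) by (cases m') auto
    obtain x M where x: "event r k = Propose x M"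
        "p = Signed i (PROPOSE (curr_view (state r k i)) x M)" "Proposing \<in> ran (state r (Suc k) i)"
      using local_step_sent_propose[OF step, of i b p] sent(1) ProposeMsg same(3) by auto
    obtain x' M' where x': "event r k' = Propose x' M'"
        "p' = Signed i (PROPOSE (curr_view (state r k' i)) x' M')"
        "can_propose f hash myval i (state r k' i) x' M'"
        "curr_view (state r (Suc k') i) = curr_view (state r k' i)"
      using local_step_sent_propose[OF step', of i b' p'] sent(2) p' same(2,3) by auto
    have "k = k'"
    proof (rule ccontr)
      assume "k \<noteq> k'"
      then have "Proposing \<in> ran (state r k' i)"
        using same_view_persistent[OF i, of "Suc k" k'] le x(3) x'(4) view by auto
      then show False
        using x'(3) by (simp add: can_propose_def)
    qed
    then show ?thesis
      using ProposeMsg p' x x' by simp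
  next
    case (PreparedMsg p)
    then obtain p' where p': "m' = PreparedMsg p'"
      using same(1) by (cases m') auto
    obtain x where x: "p = Signed i (PREPARED (curr_view (state r k i)) (hash x))"
        "curr_val (state r (Suc k) i) = Some x" "voted (state r (Suc k) i) = Some True"
      using local_step_sent_prepared[OF step] sent(1) PreparedMsg by blast
    obtain l x' M' where x': "p' = Signed i (PREPARED (curr_view (state r k' i)) (hash x'))"
        "can_vote f valid hash (state r k' i) (Signed l (PROPOSE (curr_view (state r k' i)) x' M'))"
        "curr_val (state r (Suc k') i) = Some x'"
        "curr_view (state r (Suc k') i) = curr_view (state r k' i)"
      using local_step_sent_prepared[OF step'] sent(2) p' by blast
    have "k = k'"
    proof (rule ccontr)
      assume "k \<noteq> k'"
      then have "voted (state r k' i) = Some True"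
        using same_view_persistent[OF i, of "Suc k" k'] le x(3) x'(4) view by auto
      then show False
        using x'(2) by (simp add: can_vote_def)
    qed
    then show ?thesis
      using PreparedMsg p' x x' by simp
  next
    \<comment> \<open>\<open>Prepare\<close> may be executed repeatedly in a view, so the two steps
      need not coincide; the messages agree because \<open>curr_val\<close> is fixed by the single
      vote.\<close>
    case (CommittedMsg p)
    then obtain p' where p': "m' = CommittedMsg p'"
      using same(1) by (cases m') auto
    obtain x where x: "p = Signed i (COMMITTED (curr_view (state r k i)) (hash x))"
        "voted (state r k i) = Some True" "curr_val (state r k i) = Some x"
      using local_step_sent_committed[OF step] sent(1) CommittedMsg by blast
    obtain x' where x': "p' = Signed i (COMMITTED (curr_view (state r k' i)) (hash x'))"
        "curr_val (state r k' i) = Some x'"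
      using local_step_sent_committed[OF step'] sent(2) p' by blast
    have eq: "curr_view (state r k' i) = curr_view (state r k i)"
      using same(2) CommittedMsg p' x x' by simp
    then have "x' = x"
      using same_view_persistent[OF i le] x x' by simp
    then show ?thesis
      using CommittedMsg p' x x' eq by simp
  qed
qed

lemma sent_unique:
  assumes "i \<in> correct" "(i, b, m) \<in> sent r k" "(i, b', m') \<in> sent r k'"
    and "msg_kind m = msg_kind m'" "msg_view m = msg_view m'" "msg_view m \<noteq> 1"
  shows "m = m'"
proof (cases "k \<le> k'")
  case True
  then show ?thesis
    using sent_unique_ordered assms by blast
next
  case False
  then show ?thesis
    using sent_unique_ordered[of i b' m' k' b m k] assms by simp
qed

section \<open>Timing\<close>

lemma delta_nonneg: "0 \<le> \<delta>"
  using partial_synchrony by (simp add: partially_synchronous_def)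

lemma V_pos: "1 \<le> V"
  using synchronizer by (simp add: synchronizer_spec_def)

lemma finite_entry_times: "finite {entry_time r i v |i. i \<in> correct \<and> enters r i v}"
  using finite_correct by simp

lemma entry_bounds:
  assumes "i \<in> correct" "V \<le> v"
  shows "\<exists>k. enters_at r i v k \<and> clock r k = entry_time r i v"
    and "first_entry correct r v \<le> entry_time r i v"
    and "entry_time r i v \<le> first_entry correct r v + 2 * \<delta>"
proof -
  have entered: "enters r i v"
    using synchronizer assms by (simp add: synchronizer_spec_def)
  then show "\<exists>k. enters_at r i v k \<and> clock r k = entry_time r i v"
    using entry_time_eq[OF assms(1)] by (auto simp: enters_def)
  show "first_entry correct r v \<le> entry_time r i v"
    unfolding first_entry_def by (rule Min_le[OF finite_entry_times]) (use assms entered in auto)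
  have "entry_time r i v \<le> last_entry correct r v"
    unfolding last_entry_def by (rule Max_ge[OF finite_entry_times]) (use assms entered in auto)
  then show "entry_time r i v \<le> first_entry correct r v + 2 * \<delta>"
    using synchronizer assms(2) by (fastforce simp: synchronizer_spec_def)
qed

lemma first_entry_Suc: "V \<le> v \<Longrightarrow> first_entry correct r v + F v \<le> first_entry correct r (Suc v)"
  using synchronizer by (simp add: synchronizer_spec_def)

text \<open>(P2) speaks of \<open>V\<close> only; (P5) carries the bound upwards, since monotonicity
  and \<open>F 0 = 0\<close> make \<open>F\<close> nonnegative.\<close>

lemma first_entry_after_GST:
  assumes "V \<le> v"
  shows "GST \<le> first_entry correct r v"
  using assms
proof (induction v rule: dec_induct)
  case base
  show ?case
    using synchronizer by (simp add: synchronizer_spec_def)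
next
  case (step v)
  have "0 \<le> F v"
    using monoD[OF mono_F, of 0 v] F_0 by simp
  then show ?case
    using first_entry_Suc[OF step.hyps(1)] step.IH by simp
qed

text \<open>By (P3) the process also enters \<open>Suc v\<close>, by (P1) not after the higher view,
  and by (P5) nobody correct enters \<open>Suc v\<close> earlier than the stated bound.\<close>

lemma higher_view_late:
  assumes "i \<in> correct" "V \<le> v" "v < curr_view (state r (Suc k) i)"
  shows "first_entry correct r v + F v \<le> clock r k"
proof -
  let ?u = "curr_view (state r (Suc k) i)"
  obtain k0 where k0: "k0 \<le> k" "enters_at r i ?u k0"
    using current_view_entered[OF assms(1), of "Suc k"] assms(3) less_Suc_eq_le by auto
  have "entry_time r i (Suc v) \<le> entry_time r i ?u"
  proof (cases "Suc v = ?u")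
    case False
    then have "Suc v < ?u"
      using assms(3) by simp
    moreover have "enters r i (Suc v)"
      using entry_bounds(1)[OF assms(1), of "Suc v"] assms(2) by (auto simp: enters_def)
    moreover have "enters r i ?u"
      using k0 by (auto simp: enters_def)
    ultimately show ?thesis
      using entry_time_mono[OF assms(1)] less_imp_le by blast
  qed simp
  then show ?thesis
    using first_entry_Suc[OF assms(2)] entry_bounds(2)[OF assms(1), of "Suc v"] assms(2)
      entry_time_eq[OF assms(1) k0(2)] mono_clock[OF k0(1)] by simp
qed

lemma sent_in_view_after_GST:
  assumes "i \<in> correct" "V \<le> v" "(i, b, m) \<in> sent r k" "msg_view m = v"
  shows "GST \<le> clock r k"
proof -
  have "curr_view (state r (Suc k) i) = v"
    using sent_correct(3)[OF assms(3,1)] assms(4) by simp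
  then obtain k0 where "k0 \<le> k" "enters_at r i v k0"
    using current_view_entered[OF assms(1), of "Suc k"] assms(2) V_pos less_Suc_eq_le by auto
  then show ?thesis
    using entry_bounds(2)[OF assms(1,2)] first_entry_after_GST[OF assms(2)] mono_clock
      entry_time_eq[OF assms(1)] by (metis order_trans)
qed

end

section \<open>A long view with a correct leader\<close>

locale long_view = synchronized_pbft f correct valid hash myval r GST \<delta> F V
  for f :: nat
    and correct :: "proc set"
    and valid :: "'x \<Rightarrow> bool"
    and hash :: "'x \<Rightarrow> 'h"
    and myval :: "proc \<Rightarrow> 'x"
    and r :: "('x, 'h) run"
    and GST \<delta> :: real
    and F :: "view \<Rightarrow> real"
    and V :: view +
  fixes v :: view
  assumes v_ge_V: "V \<le> v"
    and v_ge_2: "2 \<le> v"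
    and long: "6 * \<delta> < F v"
    and correct_leader: "leader f v \<in> correct"
begin

abbreviation "start \<equiv> first_entry correct r v"

text \<open>The common period of view \<open>v\<close>: all correct processes have entered it and none has left.\<close>

definition in_period :: "real \<Rightarrow> bool" where
  "in_period t \<longleftrightarrow> start + 2 * \<delta> \<le> t \<and> t < start + F v"

lemma in_period_curr_view:
  assumes "i \<in> correct" "in_period t" "last_step t k"
  shows "curr_view (state r (Suc k) i) = v"
proof -
  obtain k0 where k0: "enters_at r i v k0" "clock r k0 = entry_time r i v"
    using entry_bounds(1)[OF assms(1) v_ge_V] by blast
  have "clock r k0 \<le> t"
    using entry_bounds(3)[OF assms(1) v_ge_V] assms(2) k0(2) by (simp add: in_period_def)
  then have "v \<le> curr_view (state r (Suc k) i)"
    using entered_le_current_view[OF assms(1) k0(1)] last_step_max[OF assms(3)] by (simp add: less_Suc_eq_le)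
  moreover have "\<not> v < curr_view (state r (Suc k) i)"
    using higher_view_late[OF assms(1) v_ge_V, of k] assms(2,3)
    by (auto simp: in_period_def last_step_def)
  ultimately show ?thesis
    by simp
qed

text \<open>A buffered message cannot be displaced during the period: a correct sender sends only
  one message of each type in view \<open>v\<close>, and none for a higher view yet.\<close>

lemma delivered:
  assumes i: "i \<in> correct" and j: "j \<in> correct"
    and sent: "(i, j, m) \<in> sent r k" "msg_view m = v"
    and t: "clock r k + \<delta> \<le> t" "in_period t" "last_step t K"
  shows "m \<in> received (state r (Suc K) j)"
proof -
  let ?slot = "(msg_kind m, msg_signer m)"
  \<comment> \<open>The invariant to be carried from receipt to \<open>K\<close>: the message is
    usable, or waits in its slot while the receiver is still below view \<open>v\<close>.\<close>
  define available where "available n \<longleftrightarrow> m \<in> received (state r n j) \<or>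
    curr_view (state r n j) < v \<and> buffer (state r n j) ?slot = Some m" for n
  have signer: "msg_signer m = i"
    using sent_correct(2)[OF sent(1) i] .
  \<comment> \<open>By authenticity, any rival in the slot was sent by \<open>i\<close> itself; it
    cannot have a view above \<open>v\<close> that early, and in view \<open>v\<close> the message
    is unique.\<close>
  have same_slot: "m' = m \<or> msg_view m' < v"
    if held: "m' \<in> received (state r n j) \<or> buffer (state r n j) slot = Some m'"
      and slot: "msg_kind m' = msg_kind m" "msg_signer m' = msg_signer m" and n: "n \<le> Suc K" for n m' slot
  proof -
    obtain n' b where n': "n' < n" "(i, b, m') \<in> sent r n'"
      using held_authentic[OF j held msg_in_parts] slot(2) signer i by auto
    have "clock r n' \<le> t"
      using mono_clock[of n' K] n' n t(3) by (simp add: last_step_def)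
    then have "\<not> v < msg_view m'"
      using higher_view_late[OF i v_ge_V, of n'] sent_correct(3)[OF n'(2) i] t(2)
      by (auto simp: in_period_def)
    moreover have "msg_view m' = v \<Longrightarrow> m' = m"
      using sent_unique[OF i n'(2) sent(1) slot(1)] sent(2) v_ge_2 by simp
    ultimately show ?thesis
      by fastforce
  qed
  \<comment> \<open>After the insertion the slot holds a message of view at least \<open>v\<close>,
    which by \<open>same_slot\<close> can only be \<open>m\<close>.\<close>
  have insert: "b ?slot = Some m"
    if insert: "buffer_insert (buffer (state r n j)) m' b"
      and n: "n \<le> K" "state r (Suc n) j = (state r n j)\<lparr>buffer := b\<rparr>"
      and m: "m' = m \<or> buffer (state r n j) ?slot = Some m" for n m' b
  proof -
    obtain m'' where m'': "b ?slot = Some m''" "v \<le> msg_view m''"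
      using m buffer_insert_own[OF insert] buffer_insert_mono[OF insert, of ?slot m] sent(2)
      by blast
    then have "m'' = m \<or> msg_view m'' < v"
      using same_slot[of m'' "Suc n" ?slot] buffer_slot[OF j, of "Suc n" ?slot m''] n by simp
    then show ?thesis
      using m'' by simp
  qed
  have "GST \<le> clock r k"
    using sent_in_view_after_GST[OF i v_ge_V sent] .
  then obtain k' where k': "actor r k' = j" "event r k' = Receive i m" "clock r k' \<le> clock r k + \<delta>"
    using partial_synchrony i j sent(1) unfolding partially_synchronous_def by meson
  have "k' \<le> K"
    using last_step_max[OF t(3)] k'(3) t(1) by simp
  have first: "available (Suc k')"
  proof -
    have "local_step f valid hash myval j (state r k' j) (Receive i m) (state r (Suc k') j) (sent r k')"
      using correct_step[of k'] k' j by simp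
    then show ?thesis
    proof cases
      case (receive_buffered b)
      then show ?thesis
        using insert[of k' m b] \<open>k' \<le> K\<close> sent(2) by (simp add: available_def)
    qed (simp add: available_def)
  qed
  have next_step: "available (Suc n)" if "available n" "n \<le> K" for n
    using j
  proof (cases rule: step_cases[where k=n])
    case own
    \<comment> \<open>Serves all three rules for entering a view at once; a message still buffered
      afterwards is for a view above \<open>u\<close>.\<close>
    have entered: "available (Suc n)"
      if "received (state r (Suc n) j) = received (enter_view u (state r n j))"
        "buffer (state r (Suc n) j) = buffer (enter_view u (state r n j))"
        "curr_view (state r (Suc n) j) = u" for u
    proof -
      have "m \<in> received (state r n j) \<or> buffer (state r n j) ?slot = Some m"
        using \<open>available n\<close> by (auto simp: available_def)
      from enter_view_keeps[OF this, of u] show ?thesis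
        using that sent(2) by (simp add: available_def)
    qed
    have curr_view_enter: "curr_view (enter_view u s) = u" for u and s :: "('x, 'h) lstate"
      by (simp add: enter_view_def)
    from own(2) show ?thesis
    proof cases
      case (receive_buffered m' b j')
      have "m \<notin> received (state r n j) \<Longrightarrow> b ?slot = Some m"
        by (rule insert[of n m' b]) (use receive_buffered that in \<open>auto simp: available_def\<close>)
      with receive_buffered that(1) show ?thesis
        by (cases "m \<in> received (state r n j)") (simp_all add: available_def)
    next
      case (new_view u)
      then show ?thesis
        using entered[of u] by (simp add: curr_view_enter)
    next
      case new_view_1_leader
      then show ?thesis
        using entered[of 1] by (simp add: curr_view_enter)
    next
      case new_view_1_other
      then show ?thesis
        using entered[of 1] by (simp add: curr_view_enter)
    qed (use that(1) in \<open>auto simp: available_def\<close>)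
  qed (use that in \<open>auto simp: available_def\<close>)
  have "available n" if "Suc k' \<le> n" "n \<le> Suc K" for n
    using that
  proof (induction n rule: dec_induct)
    case base
    show ?case
      by (rule first)
  next
    case (step n)
    then show ?case
      using next_step[of n] by linarith
  qed
  then have "available (Suc K)"
    using \<open>k' \<le> K\<close> by simp
  \<comment> \<open>At \<open>K\<close> the receiver is in view \<open>v\<close>, which excludes the
    buffered alternative.\<close>
  then show ?thesis
    using in_period_curr_view[OF j t(2,3)] by (simp add: available_def)
qed

lemma delta_in_period:
  assumes "2 \<le> c" "c \<le> 6"
  shows "in_period (start + c * \<delta>)"
  using mult_right_mono[OF assms(1) delta_nonneg] mult_right_mono[OF assms(2) delta_nonneg] long
  by (simp add: in_period_def)

lemma last_step_in_period:
  assumes "in_period t"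
  shows "\<exists>k. last_step t k"
proof -
  obtain k where "clock r k \<le> start + 2 * \<delta>"
    using entry_bounds[OF correct_leader v_ge_V] by metis
  then show ?thesis
    using last_step_exists[of k t] assms by (simp add: in_period_def)
qed

text \<open>Correct processes send NEWLEADER messages on entry, at most \<open>2 * \<delta>\<close>
  after \<open>start\<close>, and one more \<open>\<delta>\<close> brings them to the leader. Those
  of a quorum of correct processes suffice, whatever faulty ones send.\<close>

lemma leader_can_propose:
  assumes "last_step (start + 3 * \<delta>) K" "Proposing \<notin> ran (state r (Suc K) (leader f v))"
  shows "\<exists>x M. can_propose f hash myval (leader f v) (state r (Suc K) (leader f v)) x M"
proof -
  let ?l = "leader f v"
  have period: "in_period (start + 3 * \<delta>)"
    by (rule delta_in_period) auto
  have current: "curr_view (state r (Suc K) ?l) = v"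
    using in_period_curr_view[OF correct_leader period assms(1)] .
  obtain Q where Q: "Q \<subseteq> correct" "quorum f Q"
    using correct_quorum_exists by blast
  obtain ent where ent: "\<And>j. j \<in> correct \<Longrightarrow> enters_at r j v (ent j)"
    and ent_time: "\<And>j. j \<in> correct \<Longrightarrow> clock r (ent j) = entry_time r j v"
    using entry_bounds(1)[OF _ v_ge_V] by metis
  \<comment> \<open>The lock is read before the entry step, as \<open>new_leader_packet\<close>
    does.\<close>
  define view where "view j = locked_view (state r (ent j) j)" for j
  define val where "val j = prepared_val (state r (ent j) j)" for j
  define m where "m j = Signed j (NEWLEADER v (view j) (val j) (cert (state r (ent j) j)))" for j
  have received: "NewLeaderMsg (m j) \<in> received (state r (Suc K) ?l)" if j: "j \<in> correct" for j
  proof -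
    have "local_step f valid hash myval j (state r (ent j) j) (NewView v)
        (state r (Suc (ent j)) j) (sent r (ent j))"
      using correct_step[of "ent j"] ent[OF j] j by (simp add: enters_at_def)
    then have "(j, ?l, NewLeaderMsg (m j)) \<in> sent r (ent j)"
      by cases (use v_ge_2 in \<open>auto simp: new_leader_packet_def m_def view_def val_def\<close>)
    moreover have "clock r (ent j) + \<delta> \<le> start + 3 * \<delta>"
      using entry_bounds(3)[OF j v_ge_V] ent_time[OF j] by simp
    ultimately show ?thesis
      using delivered[OF j correct_leader _ _ _ period assms(1)] by (simp add: m_def)
  qed
  have certified: "\<exists>y D. val j = Some y \<and> cert (state r (ent j) j) = Some D \<and>
      is_prepared f D (view j) (hash y)" if "j \<in> correct" "view j \<noteq> 0" for j
    using locked_certified[OF that(1)] that(2) unfolding view_def val_def by blast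
  have "view j < v" if "j \<in> correct" for j
    using locked_le_current_view[OF that, of "ent j"] entering_new_view(1)[OF that ent[OF that]]
    unfolding view_def by simp
  then have "valid_new_leader f hash (m j)" if "j \<in> correct" for j
    using certified that by (auto simp: m_def)
  then have quorum: "new_leader_quorum f hash v Q view val (m ` Q)"
    using Q unfolding new_leader_quorum_def
    by (auto simp: m_def intro!: exI[of _ "\<lambda>j. cert (state r (ent j) j)"])
  have fin: "finite (view ` Q)" "view ` Q \<noteq> {}"
    using finite_quorum[OF Q(2)] Q(2) by (auto simp: quorum_def)
  have "\<exists>x. if Max (view ` Q) \<noteq> 0 then \<exists>j\<in>Q. view j = Max (view ` Q) \<and> val j = Some x
      else x = myval ?l"
  proof (cases "Max (view ` Q) = 0")
    case False
    obtain j where j: "j \<in> Q" "view j = Max (view ` Q)"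
      using Max_in[OF fin] by (metis imageE)
    then obtain y where "val j = Some y"
      using certified[of j] False Q(1) by auto
    then show ?thesis
      using False j by auto
  qed simp
  then obtain x where x: "if Max (view ` Q) \<noteq> 0
      then \<exists>j\<in>Q. view j = Max (view ` Q) \<and> val j = Some x else x = myval ?l"
    by blast
  have "NewLeaderMsg ` m ` Q \<subseteq> received (state r (Suc K) ?l)"
    using received Q(1) by blast
  then have "can_propose f hash myval ?l (state r (Suc K) ?l) x (m ` Q)"
    using assms(2) quorum x unfolding can_propose_def current by blast
  then show ?thesis
    by blast
qed

lemma leader_proposes:
  "\<exists>k x M. clock r k \<le> start + 3 * \<delta> \<and>
    to_all f (leader f v) (ProposeMsg (Signed (leader f v) (PROPOSE v x M))) \<subseteq> sent r k \<and>
    safe_proposal f valid hash (Signed (leader f v) (PROPOSE v x M))"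
proof -
  let ?l = "leader f v"
  have period: "in_period (start + 3 * \<delta>)"
    by (rule delta_in_period) auto
  obtain K where K: "last_step (start + 3 * \<delta>) K"
    using last_step_in_period[OF period] by blast
  have view: "curr_view (state r (Suc K) ?l) = v"
    using in_period_curr_view[OF correct_leader period K] .
  have "Proposing \<in> ran (state r (Suc K) ?l)"
    using leader_can_propose[OF K] last_step_not_pending[OF K correct_leader]
    by (auto simp: handler_pending_def)
  then obtain k x M where k: "k < Suc K" "can_propose f hash myval ?l (state r k ?l) x M"
      "curr_view (state r k ?l) = v"
      "to_all f ?l (ProposeMsg (Signed ?l (PROPOSE v x M))) \<subseteq> sent r k"
    using propose_history[OF correct_leader, of "Suc K"] view v_ge_2 by auto
  moreover have "clock r k \<le> start + 3 * \<delta>"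
    using mono_clock[of k K] k(1) K by (simp add: last_step_def)
  ultimately show ?thesis
    using propose_safe[OF correct_leader k(2)] by metis
qed

lemma all_vote:
  "\<exists>x. \<forall>t K. \<forall>i\<in>correct. start + 4 * \<delta> \<le> t \<longrightarrow> in_period t \<longrightarrow> last_step t K \<longrightarrow>
    voted (state r (Suc K) i) = Some True \<and> curr_val (state r (Suc K) i) = Some x \<and>
    (\<exists>k\<le>K. to_all f i (PreparedMsg (Signed i (PREPARED v (hash x)))) \<subseteq> sent r k)"
proof -
  let ?l = "leader f v"
  obtain k x M where k: "clock r k \<le> start + 3 * \<delta>"
      "to_all f ?l (ProposeMsg (Signed ?l (PROPOSE v x M))) \<subseteq> sent r k"
    and safe: "safe_proposal f valid hash (Signed ?l (PROPOSE v x M))"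
    using leader_proposes by blast
  let ?p = "Signed ?l (PROPOSE v x M)"
  have "voted (state r (Suc K) i) = Some True \<and> curr_val (state r (Suc K) i) = Some x \<and>
    (\<exists>k\<le>K. to_all f i (PreparedMsg (Signed i (PREPARED v (hash x)))) \<subseteq> sent r k)"
    if i: "i \<in> correct" and t: "start + 4 * \<delta> \<le> t" "in_period t" "last_step t K" for t K i
  proof -
    have sent: "(?l, i, ProposeMsg ?p) \<in> sent r k"
      using k(2) i correct_procs by (auto simp: to_all_def)
    have received: "ProposeMsg ?p \<in> received (state r (Suc K) i)"
      by (rule delivered[OF correct_leader i sent _ _ t(2,3)]) (use k(1) t(1) in auto)
    have view: "curr_view (state r (Suc K) i) = v"
      using in_period_curr_view[OF i t(2,3)] .
    have "\<not> can_vote f valid hash (state r (Suc K) i) ?p"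
      using last_step_not_pending[OF t(3) i] by (auto simp: handler_pending_def)
    then have "voted (state r (Suc K) i) \<noteq> Some False"
      using received safe view by (simp add: can_vote_def del: safe_proposal.simps)
    then have voted: "voted (state r (Suc K) i) = Some True"
      using voted_defined[OF i, of "Suc K"] view v_ge_2 by auto
    then obtain k' l y N where k': "k' \<le> K" "curr_val (state r (Suc K) i) = Some y"
        "can_vote f valid hash (state r k' i) (Signed l (PROPOSE v y N))"
        "to_all f i (PreparedMsg (Signed i (PREPARED v (hash y)))) \<subseteq> sent r k'"
      using vote_history[OF i, of "Suc K"] view less_Suc_eq_le by auto
    let ?q = "Signed l (PROPOSE v y N)"
    have l: "l = ?l" and q: "ProposeMsg ?q \<in> received (state r k' i)"
      using k'(3) by (auto simp: can_vote_def)
    obtain k'' b where "(?l, b, ProposeMsg ?q) \<in> sent r k''"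
      using held_authentic[OF i disjI1, OF q msg_in_parts] l correct_leader by auto
    then have "?p = ?q"
      using sent_unique[OF correct_leader sent] v_ge_2 by fastforce
    then show ?thesis
      using voted k' by auto
  qed
  then show ?thesis
    by blast
qed

lemma all_decide:
  assumes i: "i \<in> correct"
  shows "decides r i"
proof -
  obtain x where vote: "\<And>t K i. i \<in> correct \<Longrightarrow> start + 4 * \<delta> \<le> t \<Longrightarrow> in_period t \<Longrightarrow> last_step t K \<Longrightarrow>
    voted (state r (Suc K) i) = Some True \<and> curr_val (state r (Suc K) i) = Some x \<and>
    (\<exists>k\<le>K. to_all f i (PreparedMsg (Signed i (PREPARED v (hash x)))) \<subseteq> sent r k)"
    using all_vote by blast
  obtain Q where Q: "Q \<subseteq> correct" "quorum f Q"
    using correct_quorum_exists by blast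
  have period: "in_period (start + 4 * \<delta>)" "in_period (start + 5 * \<delta>)" "in_period (start + 6 * \<delta>)"
    by (rule delta_in_period; simp)+
  obtain K4 K5 K6 where K: "last_step (start + 4 * \<delta>) K4" "last_step (start + 5 * \<delta>) K5"
      "last_step (start + 6 * \<delta>) K6"
    using last_step_in_period period by metis
  have times: "start + 4 * \<delta> \<le> start + 5 * \<delta>" "start + 4 * \<delta> \<le> start + 6 * \<delta>"
    using delta_nonneg by auto

  have prepared_received: "PreparedMsg (Signed j (PREPARED v (hash x))) \<in> received (state r (Suc K5) i)"
    if j: "j \<in> correct" and i: "i \<in> correct" for i j
  proof -
    obtain k where k: "k \<le> K4" "to_all f j (PreparedMsg (Signed j (PREPARED v (hash x)))) \<subseteq> sent r k"
      using vote[OF j order_refl period(1) K(1)] by blast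
    then have "(j, i, PreparedMsg (Signed j (PREPARED v (hash x)))) \<in> sent r k"
      using i correct_procs by (auto simp: to_all_def)
    then show ?thesis
      using delivered[OF j i _ _ _ period(2) K(2)] mono_clock[OF k(1)] K(1)
      by (simp add: last_step_def)
  qed
  have committed: "\<exists>k\<le>K5. to_all f i (CommittedMsg (Signed i (COMMITTED v (hash x)))) \<subseteq> sent r k"
    and locked: "Preparing \<in> ran (state r (Suc K5) i)" if i: "i \<in> correct" for i
  proof -
    have view: "curr_view (state r (Suc K5) i) = v"
      using in_period_curr_view[OF i period(2) K(2)] .
    have val: "voted (state r (Suc K5) i) = Some True" "curr_val (state r (Suc K5) i) = Some x"
      using vote[OF i times(1) period(2) K(2)] by auto
    have "can_prepare f hash (state r (Suc K5) i) ((\<lambda>j. Signed j (PREPARED v (hash x))) ` Q) x"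
      using prepared_received[OF _ i] Q val view by (auto simp: can_prepare_def is_prepared_def)
    then show ran: "Preparing \<in> ran (state r (Suc K5) i)"
      using last_step_not_pending[OF K(2) i] by (auto simp: handler_pending_def)
    then show "\<exists>k\<le>K5. to_all f i (CommittedMsg (Signed i (COMMITTED v (hash x)))) \<subseteq> sent r k"
      using prepare_history[OF i ran] view val(2) less_Suc_eq_le by auto
  qed

  have view: "curr_view (state r (Suc K6) i) = v"
    using in_period_curr_view[OF i period(3) K(3)] .
  have "CommittedMsg (Signed j (COMMITTED v (hash x))) \<in> received (state r (Suc K6) i)"
    if j: "j \<in> correct" for j
  proof -
    obtain k where k: "k \<le> K5" "to_all f j (CommittedMsg (Signed j (COMMITTED v (hash x)))) \<subseteq> sent r k"
      using committed[OF j] by blast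
    then have "(j, i, CommittedMsg (Signed j (COMMITTED v (hash x)))) \<in> sent r k"
      using i correct_procs by (auto simp: to_all_def)
    then show ?thesis
      using delivered[OF j i _ _ _ period(3) K(3)] mono_clock[OF k(1)] K(2)
      by (simp add: last_step_def)
  qed
  moreover have "locked_view (state r (Suc K6) i) = v"
  proof -
    have "K5 \<le> K6"
      using last_step_max[OF K(3), of K5] K(2) delta_nonneg by (simp add: last_step_def)
    then have "Preparing \<in> ran (state r (Suc K6) i)"
      using same_view_persistent[OF i, of "Suc K5" "Suc K6"] locked[OF i] view
        in_period_curr_view[OF i period(2) K(2)] by auto
    then show ?thesis
      using prepare_history[OF i] view by simp
  qed
  moreover have "curr_val (state r (Suc K6) i) = Some x"
    using vote[OF i times(2) period(3) K(3)] by simp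
  ultimately have "can_decide f hash (state r (Suc K6) i) x"
    using Q view unfolding can_decide_def by (auto intro!: exI[of _ Q])
  then have "Deciding \<in> ran (state r (Suc K6) i)"
    using last_step_not_pending[OF K(3) i] by (auto simp: handler_pending_def)
  then show ?thesis
    by (rule decide_history[OF i])
qed

end

lemma leader_recurs:
  assumes "i \<in> procs f"
  shows "\<exists>v\<ge>N. leader f v = i"
proof (intro exI conjI)
  let ?v = "i + (3 * f + 1) * N"
  have "?v - 1 = (i - 1) + (3 * f + 1) * N" "i - 1 < 3 * f + 1"
    using assms by (auto simp: procs_def)
  then have "(?v - 1) mod (3 * f + 1) = i - 1"
    by (metis mod_less mod_mult_self2)
  then show "leader f ?v = i"
    using assms by (simp add: leader_def procs_def)
qed simp

theorem corollary51:
  fixes f :: nat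
    and correct :: "proc set"
    and valid :: "'x \<Rightarrow> bool"
    and hash :: "'x \<Rightarrow> 'h"
    and myval :: "proc \<Rightarrow> 'x"
    and r :: "('x, 'h) run"
    and GST \<delta> :: real
    and F :: "view \<Rightarrow> real"
    and V :: view
  assumes "correct \<subseteq> procs f"
    and "card (procs f - correct) \<le> f"
    and "inj hash"
    and "\<forall>i\<in>correct. valid (myval i)"
    and "pbft_run f correct valid hash myval r"
    and "partially_synchronous correct GST \<delta> r"
    and "mono F"
    and "F 0 = 0"
    and "synchronizer_spec correct GST V (2 * \<delta>) F r"
    and "\<forall>\<theta>. \<exists>v\<ge>1. \<forall>v'\<ge>v. F v' > \<theta>"
  shows "\<forall>i\<in>correct. decides r i"
proof
  fix i
  assume i: "i \<in> correct"
  obtain u where u: "\<And>v'. u \<le> v' \<Longrightarrow> 6 * \<delta> < F v'"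
    using assms(10) by blast
  obtain v where v: "u + V + 2 \<le> v" "leader f v = i"
    using leader_recurs[of i f "u + V + 2"] i assms(1) by blast
  interpret long_view f correct valid hash myval r GST \<delta> F V v
    by unfold_locales (use assms(1-9) i u v in auto)
  show "decides r i"
    using all_decide[OF i] .
qed

end
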